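(* For all positive integers $N$ and $k$ with $k\ge 3$, the following hold: (a) $g(N,k)\le g(N+1,k)$; (b) $\frac{k+1}{k}\,g(N,k)\le g(N,k+1)$.
   Context: A state with $k$ vessels is a vector $A=(a_1,\dots,a_k)$ of non-negative integers (the contents of the vessels). A pouring step chooses two distinct vessels with contents $x$ and $y$, where $x\le y$, and replaces these contents by $2x$ (for the vessel that contained $x$) and $y-x$ (for the vessel that contained $y$); all other contents are unchanged. For an integer $p\ge 0$, a state is $p$-pourable if some sequence of at most $p$ pouring steps leads to a state in which at least one vessel has content $0$. For positive integers $N$ and $k\ge 3$, $g(N,k)$ is the smallest positive integer $n$ such that some state $A=(a_1,\dots,a_k)$ with $a_1+\cdots+a_k=n$ is not $(N-1)$-pourable. *)

theory Defs
  imports Complex_Main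
begin

text \<open>A state with \<open>k\<close> vessels is a list of length \<open>k\<close> over the natural numbers.\<close>

inductive pour_step :: "nat list \<Rightarrow> nat list \<Rightarrow> bool" where
  pour: "\<lbrakk>i < length A; j < length A; i \<noteq> j; A ! i \<le> A ! j\<rbrakk>
    \<Longrightarrow> pour_step A (A[i := 2 * (A ! i), j := A ! j - A ! i])"

definition pourable :: "nat \<Rightarrow> nat list \<Rightarrow> bool" where
  "pourable p A \<longleftrightarrow> (\<exists>m\<le>p. \<exists>B. (pour_step ^^ m) A B \<and> 0 \<in> set B)"

text \<open>
  For \<open>N \<ge> 1\<close> and \<open>k \<ge> 3\<close> the minimum is attained: a fixed sequence of pouring steps
  empties a vessel only if the initial contents satisfy a nontrivial linear equation, and finitely
  many such equations cannot cover all states. So \<open>LEAST\<close> is the true minimum there.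
\<close>

definition g :: "nat \<Rightarrow> nat \<Rightarrow> nat" where
  "g N k = (LEAST n. n > 0 \<and>
     (\<exists>A. length A = k \<and> sum_list A = n \<and> \<not> pourable (N - 1) A))"

end

theory Submission
  imports Defs
begin

text \<open>
  A sequence of \<open>m\<close> pouring steps acts as an invertible integer matrix with entries bounded by
  \<open>2 ^ m\<close>, so a state whose contents are consecutive powers of a base larger than \<open>2 ^ p\<close> is not
  \<open>p\<close>-pourable; hence the minimum defining \<open>g\<close> is attained. Part (a) is then immediate. For (b),
  removing the fullest vessel from an optimal state with \<open>k + 1\<close> vessels preserves
  non-pourability, because the removed vessel can always be left idle, and removes at least the
  average content.
\<close>

lemma pourable_mono: "p \<le> q \<Longrightarrow> pourable p A \<Longrightarrow> pourable q A"
  unfolding pourable_def by (meson order_trans)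

lemma zero_notin_if_not_pourable:
  assumes "\<not> pourable p A"
  shows "0 \<notin> set A"
proof
  assume "0 \<in> set A"
  moreover have "(pour_step ^^ 0) A A" by simp
  ultimately show False using assms unfolding pourable_def by blast
qed

lemma sum_list_pos_if_not_pourable:
  assumes "\<not> pourable p A" and "A \<noteq> []"
  shows "sum_list A > 0"
  using zero_notin_if_not_pourable[OF assms(1)] assms(2) by (cases A) auto

text \<open>Positions of \<open>B\<close> outside the range of \<open>f\<close> are extra vessels.
  Injectivity is required on all of \<open>nat\<close>, so that \<open>inj_eq\<close> rewrites
  without side conditions.\<close>

definition embeds :: "(nat \<Rightarrow> nat) \<Rightarrow> nat list \<Rightarrow> nat list \<Rightarrow> bool" where
  "embeds f A B \<longleftrightarrow> inj f \<and> (\<forall>i<length A. f i < length B \<and> B ! f i = A ! i)"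

text \<open>The same pour is made between the vessels \<open>f i\<close> and \<open>f j\<close>;
  injectivity keeps it away from the images of all other vessels.\<close>

lemma pour_step_embeds:
  assumes "pour_step A B" and "embeds f A A'"
  shows "\<exists>B'. pour_step A' B' \<and> embeds f B B'"
  using assms(1)
proof cases
  case (pour i j)
  have f: "inj f" "\<And>i. i < length A \<Longrightarrow> f i < length A' \<and> A' ! f i = A ! i"
    using assms(2) by (auto simp: embeds_def)
  define B' where "B' = A'[f i := 2 * (A' ! f i), f j := A' ! f j - A' ! f i]"
  have "pour_step A' B'"
    unfolding B'_def using pour f by (intro pour_step.pour) (auto simp: inj_eq)
  moreover have "embeds f B B'"
    using pour f by (auto simp: embeds_def B'_def nth_list_update inj_eq)
  ultimately show ?thesis by blast
qed

lemma relpowp_pour_step_embeds: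
  assumes "(pour_step ^^ m) A B" and "embeds f A A'"
  shows "\<exists>B'. (pour_step ^^ m) A' B' \<and> embeds f B B'"
  using assms(1)
proof (induction m arbitrary: B)
  case 0
  then show ?case using assms(2) by auto
next
  case (Suc m)
  then obtain C where "(pour_step ^^ m) A C" "pour_step C B" by auto
  then show ?case using Suc.IH pour_step_embeds by (metis relpowp_Suc_I)
qed

lemma pourable_embeds:
  assumes "pourable p A" and "embeds f A A'"
  shows "pourable p A'"
proof -
  obtain m B where B: "m \<le> p" "(pour_step ^^ m) A B" "0 \<in> set B"
    using assms(1) unfolding pourable_def by blast
  then obtain B' where B': "(pour_step ^^ m) A' B'" "embeds f B B'"
    using relpowp_pour_step_embeds assms(2) by blast
  then have "0 \<in> set B'"
    using B(3) unfolding embeds_def by (metis in_set_conv_nth)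
  then show ?thesis using B B' unfolding pourable_def by blast
qed

lemma embeds_remove: "embeds (\<lambda>i. if i < length xs then i else Suc i) (xs @ ys) (xs @ a # ys)"
  by (auto simp: embeds_def inj_def nth_append Suc_diff_le split: if_splits)

text \<open>
  The last conjunct expresses invertibility of the matrix \<open>c\<close> by surjectivity, which is easy to
  propagate through a step.
\<close>

lemma relpowp_pour_step_linear:
  assumes "(pour_step ^^ m) A B"
  shows "length B = length A \<and> (\<exists>c :: nat \<Rightarrow> nat \<Rightarrow> int.
    (\<forall>l<length A. int (B ! l) = (\<Sum>i<length A. c l i * int (A ! i))) \<and>
    (\<forall>l i. \<bar>c l i\<bar> \<le> 2 ^ m) \<and>
    (\<forall>t :: nat \<Rightarrow> real. \<exists>x. \<forall>l<length A. (\<Sum>i<length A. of_int (c l i) * x i) = t l))"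
  using assms
proof (induction m arbitrary: B)
  case 0
  have *: "(\<Sum>i<n. (if l = i then 1 else 0) * x i) = x l"
    if "l < n" for x :: "nat \<Rightarrow> 'a::comm_ring_1" and l n
    using that by (simp add: if_distrib[of "\<lambda>u. u * _"] sum.delta' cong: if_cong)
  \<comment> \<open>The surjectivity conjunct casts integer coefficients to reals, so the identity
    matrix is also needed in this cast form.\<close>
  have **: "(\<Sum>i<n. real_of_int (if l = i then 1 else 0) * x i) = x l" if "l < n"
    for x :: "nat \<Rightarrow> real" and l n
    using *[OF that, of x] by (simp add: if_distrib[of real_of_int] cong: if_cong)
  show ?case
    using 0 by (intro conjI exI[of _ "\<lambda>l i. if l = i then 1 else 0"]) (auto simp: * **)
next
  case (Suc m)
  let ?n = "length A"
  obtain C where "(pour_step ^^ m) A C" and step: "pour_step C B"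
    using Suc.prems by auto
  then obtain c :: "nat \<Rightarrow> nat \<Rightarrow> int" where len: "length C = ?n"
    and C: "\<And>l. l < ?n \<Longrightarrow> int (C ! l) = (\<Sum>i<?n. c l i * int (A ! i))"
    and bound: "\<And>l i. \<bar>c l i\<bar> \<le> 2 ^ m"
    and surj: "\<And>t :: nat \<Rightarrow> real. \<exists>x. \<forall>l<?n. (\<Sum>i<?n. of_int (c l i) * x i) = t l"
    using Suc.IH[of C] by auto
  from step obtain i j where ij: "i < ?n" "j < ?n" "i \<noteq> j" "C ! i \<le> C ! j"
    and B: "B = C[i := 2 * (C ! i), j := C ! j - C ! i]"
    using len by cases auto
  \<comment> \<open>The pour as a row operation: both new rows are built from the old rows of
    \<open>c\<close>.\<close>
  define d where "d = c(i := \<lambda>s. 2 * c i s, j := \<lambda>s. c j s - c i s)"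
  have "int (B ! l) = (\<Sum>s<?n. d l s * int (A ! s))" if "l < ?n" for l
    using that ij len C
    by (auto simp: B d_def nth_list_update of_nat_diff left_diff_distrib sum_subtractf
        sum_distrib_left mult.assoc)
  moreover have "\<bar>d l s\<bar> \<le> 2 ^ Suc m" for l s
    using bound[of l s] bound[of i s] bound[of j s] by (auto simp: d_def)
  moreover have "\<exists>x. \<forall>l<?n. (\<Sum>s<?n. of_int (d l s) * x s) = t l" for t :: "nat \<Rightarrow> real"
  proof -
    \<comment> \<open>The target is pulled back through the row operation: doubling row
      \<open>i\<close> undoes the half, and subtracting old row \<open>i\<close> from row
      \<open>j\<close> removes the added \<open>t i / 2\<close>. The halving is why surjectivity is
      stated over the reals.\<close>
    obtain x where x: "\<And>l. l < ?n \<Longrightarrow>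
        (\<Sum>s<?n. of_int (c l s) * x s) = (t(i := t i / 2, j := t j + t i / 2)) l"
      using surj by blast
    have "(\<Sum>s<?n. of_int (d l s) * x s) = t l" if "l < ?n" for l
    proof -
      have "(\<Sum>s<?n. of_int (2 * c i s) * x s) = 2 * (\<Sum>s<?n. of_int (c i s) * x s)"
        by (simp add: sum_distrib_left mult.assoc)
      moreover have "(\<Sum>s<?n. of_int (c j s - c i s) * x s)
          = (\<Sum>s<?n. of_int (c j s) * x s) - (\<Sum>s<?n. of_int (c i s) * x s)"
        by (simp add: left_diff_distrib sum_subtractf)
      ultimately show ?thesis
        using x[OF that] x[OF ij(1)] x[OF ij(2)] ij(3) unfolding d_def
        by (cases "l = j"; cases "l = i") (simp_all del: of_int_mult of_int_diff)
    qed
    then show ?thesis by blast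
  qed
  ultimately show ?case using len B by auto
qed

text \<open>Uniqueness of signed base-\<open>M\<close> digits for zero: reduction modulo
  \<open>M\<close> kills the lowest digit, then a factor \<open>M\<close> cancels and induction
  applies.\<close>

lemma digits_zero:
  fixes c :: "nat \<Rightarrow> int"
  assumes "(\<Sum>i<n. c i * M ^ i) = 0" and "\<And>i. \<bar>c i\<bar> < M" and "i < n"
  shows "c i = 0"
  using assms
proof (induction n arbitrary: c i)
  case (Suc n)
  have eq: "c 0 + M * (\<Sum>i<n. c (Suc i) * M ^ i) = 0"
    using Suc.prems(1) unfolding sum.lessThan_Suc_shift
    by (simp add: sum_distrib_left algebra_simps)
  then have "c 0 = M * (- (\<Sum>i<n. c (Suc i) * M ^ i))"
    by simp
  then have "M dvd c 0" by (rule dvdI)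
  then have c0: "c 0 = 0"
    using Suc.prems(2)[of 0] dvd_imp_le_int[of "c 0" M] by linarith
  have "M > 0" using Suc.prems(2)[of 0] by linarith
  then have "(\<Sum>i<n. c (Suc i) * M ^ i) = 0" using eq c0 by simp
  then have "c (Suc i) = 0" if "i < n" for i
    using Suc.IH[of "\<lambda>i. c (Suc i)"] Suc.prems(2) that by blast
  then show ?case using c0 Suc.prems(3) by (cases i) auto
qed simp

text \<open>An emptied vessel gives a vanishing combination of powers of \<open>2 ^ Suc p\<close>
  whose coefficients are smaller than this base. So a whole row of the matrix is zero, contradicting
  invertibility.\<close>

lemma powers_not_pourable: "\<not> pourable p (map (\<lambda>i. (2 ^ Suc p) ^ i) [0..<k])"
proof
  let ?A = "map (\<lambda>i. (2 ^ Suc p) ^ i) [0..<k] :: nat list"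
  assume "pourable p ?A"
  then obtain m B where B: "m \<le> p" "(pour_step ^^ m) ?A B" "0 \<in> set B"
    unfolding pourable_def by blast
  obtain c :: "nat \<Rightarrow> nat \<Rightarrow> int" where len: "length B = k"
    and lin: "\<And>l. l < k \<Longrightarrow> int (B ! l) = (\<Sum>i<k. c l i * int (?A ! i))"
    and bound: "\<And>l i. \<bar>c l i\<bar> \<le> 2 ^ m"
    and surj: "\<And>t :: nat \<Rightarrow> real. \<exists>x. \<forall>l<k. (\<Sum>i<k. of_int (c l i) * x i) = t l"
    using relpowp_pour_step_linear[OF B(2)] by auto
  obtain l where l: "l < k" "B ! l = 0"
    using B(3) len by (metis in_set_conv_nth)
  have "(\<Sum>i<k. c l i * (2 ^ Suc p) ^ i) = 0"
    using lin[OF l(1)] l(2) by simp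
  moreover have "(2::int) ^ m < 2 ^ Suc p"
    using B(1) by (intro power_strict_increasing) auto
  then have "\<bar>c l i\<bar> < 2 ^ Suc p" for i
    using bound[of l i] by linarith
  ultimately have "\<And>i. i < k \<Longrightarrow> c l i = 0"
    using digits_zero by blast
  \<comment> \<open>A zero row cannot attain the value 1.\<close>
  moreover obtain x where "(\<Sum>i<k. of_int (c l i) * x i) = (1::real)"
    using surj[of "\<lambda>_. 1"] l(1) by blast
  ultimately show False by simp
qed

lemma g_le:
  assumes "\<not> pourable (N - 1) A" and "A \<noteq> []"
  shows "g N (length A) \<le> sum_list A"
  unfolding g_def using assms sum_list_pos_if_not_pourable[OF assms]
  by (intro Least_le) blast

text \<open>\<open>LEAST\<close> has the defining property only if some number has it; the state of
  powers supplies one.\<close>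

lemma g_attained:
  assumes "k > 0"
  obtains A where "length A = k" "sum_list A = g N k" "\<not> pourable (N - 1) A"
proof -
  let ?P = "\<lambda>n. n > 0 \<and> (\<exists>A. length A = k \<and> sum_list A = n \<and> \<not> pourable (N - 1) A)"
  let ?A = "map (\<lambda>i. (2 ^ Suc (N - 1)) ^ i) [0..<k] :: nat list"
  have A: "\<not> pourable (N - 1) ?A" by (rule powers_not_pourable)
  have "length ?A = k" by simp
  moreover have "sum_list ?A > 0"
    using assms by (intro sum_list_pos_if_not_pourable[OF A]) simp
  ultimately have "?P (sum_list ?A)" using A by blast
  then have "?P (g N k)" unfolding g_def by (rule LeastI)
  then show ?thesis using that by blast
qed

lemma g_mono_steps:
  assumes "N \<le> N'" and "k > 0"
  shows "g N k \<le> g N' k"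
proof -
  obtain A where A: "length A = k" "sum_list A = g N' k" "\<not> pourable (N' - 1) A"
    using g_attained[OF assms(2)] .
  have "\<not> pourable (N - 1) A"
    using A(3) pourable_mono[of "N - 1" "N' - 1"] assms(1) by auto
  then show ?thesis using g_le[of N A] A assms(2) by auto
qed

text \<open>Part (b) with the denominator cleared, so that the averaging argument stays in
  \<open>nat\<close>.\<close>

lemma g_Suc_vessels:
  assumes "k > 0"
  shows "(k + 1) * g N k \<le> k * g N (k + 1)"
proof -
  obtain A where A: "length A = k + 1" "sum_list A = g N (k + 1)" "\<not> pourable (N - 1) A"
    using g_attained[of "k + 1"] by auto
  define a where "a = Max (set A)"
  have "a \<in> set A" unfolding a_def using A(1) by (intro Max_in) auto
  then obtain xs ys where split: "A = xs @ a # ys" by (meson split_list)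
  have "\<not> pourable (N - 1) (xs @ ys)"
    using A(3) pourable_embeds[OF _ embeds_remove] unfolding split by blast
  moreover have len: "length (xs @ ys) = k" using A(1) split by simp
  ultimately have g: "g N k \<le> sum_list (xs @ ys)"
    using g_le[of N "xs @ ys"] assms by fastforce
  have "x \<le> a" if "x \<in> set (xs @ ys)" for x
    unfolding a_def using that split by (intro Max_ge) auto
  then have "sum_list (xs @ ys) \<le> k * a"
    using sum_list_mono[of "xs @ ys" "\<lambda>x. x" "\<lambda>_. a"] unfolding len[symmetric]
    by (simp add: sum_list_triv algebra_simps)
  \<comment> \<open>Adding \<open>k * sum_list (xs @ ys)\<close> to both sides of the previous bound
    turns its right side into \<open>k * sum_list A\<close>.\<close>
  then have "(k + 1) * sum_list (xs @ ys) \<le> k * sum_list A"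
    by (simp add: split algebra_simps)
  then show ?thesis
    using A(2) mult_le_mono2[OF g, of "k + 1"] by simp
qed

theorem theorem21:
  fixes N k :: nat
  assumes "N \<ge> 1" and "k \<ge> 3"
  shows "g N k \<le> g (N + 1) k \<and>
    (real k + 1) / real k * real (g N k) \<le> real (g N (k + 1))"
proof
  show "g N k \<le> g (N + 1) k" using assms by (intro g_mono_steps) auto
  have "real ((k + 1) * g N k) \<le> real (k * g N (k + 1))"
    using assms by (intro of_nat_mono g_Suc_vessels) auto
  then show "(real k + 1) / real k * real (g N k) \<le> real (g N (k + 1))"
    using assms by (simp add: field_simps)
qed

end
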